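(* Let $n\ge 1$ be the number of participants, let $X=(X_1,\dots,X_n)$ be the (random) participant feature histories and $y=(y_1,\dots,y_n)$ the (random) participant labels. Let $A$ be a fully specified, possibly randomized analysis, i.e. a measurable map $(X,y,u)\mapsto A(X,y,u)\in\mathbb{R}$ that sends a labelled participant dataset together with a realization $u$ of its randomization (seed schedule) to a scalar statistic. Let $U$ denote the random seed schedule; $U$ is conditionally independent of $y$ given $X$, and the same $U$ is used for the observed and for every permuted dataset (that is, $A$ and its randomization policy are applied identically to the observed and to every permuted dataset). Assume the null hypothesis that the participant labels are exchangeable conditional on the feature histories: for every permutation $\sigma$ of $\{1,\dots,n\}$, the conditional distribution of $(y_{\sigma(1)},\dots,y_{\sigma(n)})$ given $X$ equals the conditional distribution of $(y_1,\dots,y_n)$ given $X$. Let $B\ge 1$, let $\pi_1,\dots,\pi_B$ be independent uniformly distributed permutations of $\{1,\dots,n\}$, jointly independent of $(X,y,U)$, and put $$T_{\mathrm{obs}}=A(X,y,U),\qquad T_b=A(X,\pi_b(y),U)\quad(b=1,\dots,B),\qquad p=\frac{1+\sum_{b=1}^{B}\mathbf{1}[T_b\ge T_{\mathrm{obs}}]}{B+1},$$ where $\pi_b(y)=(y_{\pi_b(1)},\dots,y_{\pi_b(n)})$. Then the permutation test that rejects when $p\le\alpha$ controls the Type-I error at level $\alpha$: for every $\alpha\in(0,1)$, under the null hypothesis, $$\mathbb{P}(p\le\alpha)\le\alpha .$$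
   Context: Each participant $i$ contributes a feature history $X_i=(x_{i1},\dots,x_{im_i})$ consisting of all of that participant's windows $x_{ij}$, and has one outcome label $y_i$. A labelled participant dataset is a pair $(X,y)$. Permuting labels means that participant $i$'s entire feature history is kept intact and all of its windows receive the common reassigned label $y_{\pi(i)}$. The analysis $A$ denotes the complete procedure producing the reported scalar statistic, including every data-dependent step (label-dependent fold construction, preprocessing, tuning, calibration, and selection among candidate pipelines); it is recomputed from the beginning on each permuted dataset, with no fitted object carried over from the observed labelling. For the statement, $A$ is an arbitrary measurable function of the feature histories, the label vector and the seed schedule. The test is one-sided, with large values of the statistic counting against the null. *)

theory Defs
  imports "HOL-Probability.Probability"
begin

text \<open>
  A feature history is the finite list of a participant's windows, each window being a point of
  the measurable space \<open>W\<close>; the number of windows may differ between participants and may be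
  random. The sigma-algebra on lists is the usual one on the disjoint union of the finite powers
  of \<open>W\<close>, generated by the measurable rectangles
  \<open>listset [A\<^sub>1, \<dots>, A\<^sub>k] = {[w\<^sub>1, \<dots>, w\<^sub>k]. w\<^sub>1 \<in> A\<^sub>1 \<and> \<dots> \<and> w\<^sub>k \<in> A\<^sub>k}\<close> of all lengths \<open>k\<close>.
\<close>

definition history_space :: "'w measure \<Rightarrow> 'w list measure" where
  "history_space W = sigma (lists (space W)) {listset As | As. As \<in> lists (sets W)}"

definition histories_space :: "nat \<Rightarrow> 'w measure \<Rightarrow> (nat \<Rightarrow> 'w list) measure" where
  "histories_space n W = PiM {1..n} (\<lambda>_. history_space W)"

definition labels_space :: "nat \<Rightarrow> 'l measure \<Rightarrow> (nat \<Rightarrow> 'l) measure" where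
  "labels_space n L = PiM {1..n} (\<lambda>_. L)"

definition perms_space :: "nat \<Rightarrow> (nat \<Rightarrow> nat) measure" where
  "perms_space n = count_space {\<sigma>. \<sigma> permutes {1..n}}"

text \<open>The restriction keeps the result in the carrier of \<open>PiM\<close>, whose points are functions
  that are undefined outside the index set.\<close>

definition permute_labels :: "nat \<Rightarrow> (nat \<Rightarrow> nat) \<Rightarrow> (nat \<Rightarrow> 'l) \<Rightarrow> (nat \<Rightarrow> 'l)" where
  "permute_labels n \<sigma> y = (\<lambda>i\<in>{1..n}. y (\<sigma> i))"

text \<open>A version of the conditional probability \<open>P(E | Z)\<close>, where \<open>Z\<close> is a random variable with
  values in \<open>S\<close>.\<close>

definition cond_prob_given ::
    "'a measure \<Rightarrow> 'b measure \<Rightarrow> ('a \<Rightarrow> 'b) \<Rightarrow> 'a set \<Rightarrow> 'a \<Rightarrow> real" where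
  "cond_prob_given M S Z E = real_cond_exp M (vimage_algebra (space M) Z S) (indicator E)"

text \<open>Regular conditional distributions need not exist for arbitrary measurable spaces. Equality of
  conditional distributions therefore means that, for every measurable set of values, the
  conditional probabilities agree almost surely; conditional independence is treated likewise.\<close>

definition cond_distr_eq ::
    "'a measure \<Rightarrow> 'b measure \<Rightarrow> ('a \<Rightarrow> 'b) \<Rightarrow> 'c measure \<Rightarrow> ('a \<Rightarrow> 'c) \<Rightarrow> ('a \<Rightarrow> 'c) \<Rightarrow> bool" where
  "cond_distr_eq M S Z N V V' \<longleftrightarrow>
     (\<forall>C\<in>sets N. AE \<omega> in M.
        cond_prob_given M S Z (V -` C \<inter> space M) \<omega> = cond_prob_given M S Z (V' -` C \<inter> space M) \<omega>)"

definition cond_indep_var ::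
    "'a measure \<Rightarrow> 'b measure \<Rightarrow> ('a \<Rightarrow> 'b) \<Rightarrow> 'c measure \<Rightarrow> ('a \<Rightarrow> 'c) \<Rightarrow> 'd measure \<Rightarrow> ('a \<Rightarrow> 'd) \<Rightarrow> bool"
  where
  "cond_indep_var M S Z N V K U \<longleftrightarrow>
     (\<forall>C\<in>sets N. \<forall>D\<in>sets K. AE \<omega> in M.
        cond_prob_given M S Z ((V -` C \<inter> space M) \<inter> (U -` D \<inter> space M)) \<omega> =
        cond_prob_given M S Z (V -` C \<inter> space M) \<omega> * cond_prob_given M S Z (U -` D \<inter> space M) \<omega>)"

definition permutation_p_value :: "nat \<Rightarrow> real \<Rightarrow> (nat \<Rightarrow> real) \<Rightarrow> real" where
  "permutation_p_value B t_obs t = (1 + (\<Sum>b=1..B. of_bool (t b \<ge> t_obs))) / (real B + 1)"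

end

theory Submission
  imports Defs
begin

text \<open>
  Exchangeability given \<open>X\<close>, together with conditional independence of \<open>y\<close> and \<open>U\<close>, makes
  \<open>(X, \<tau>(y), U)\<close> equal in law to \<open>(X, y, U)\<close> for every permutation \<open>\<tau>\<close>. Relabelling by a
  uniform \<open>\<tau>\<close> turns the observed statistic and the \<open>B\<close> permuted ones into \<open>B + 1\<close> statistics
  indexed by independent uniform permutations \<open>\<tau>, \<tau> \<circ> \<pi>\<^sub>1, \<dots>, \<tau> \<circ> \<pi>\<^sub>B\<close>, so the observed one is
  exchangeable with the others. Since at most \<open>r\<close> indices \<open>j\<close> can satisfy \<open>#{b. t\<^sub>b \<ge> t\<^sub>j} \<le> r\<close>,
  the observed index does so with probability at most \<open>r / (B + 1)\<close>; take \<open>r = \<alpha> (B + 1)\<close>.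
\<close>

section \<open>Joint law of a triple under conditional independence\<close>

text \<open>Boxes are the pi-system on which two joint laws will be compared. The three projections
  are measurable for the sigma-algebra generated by boxes, which makes the identity measurable into
  the product.\<close>

lemma sets_triple_measure:
  "sets (S \<Otimes>\<^sub>M N \<Otimes>\<^sub>M K) =
    sigma_sets (space S \<times> space N \<times> space K)
      {A \<times> C \<times> D | A C D. A \<in> sets S \<and> C \<in> sets N \<and> D \<in> sets K}"
    (is "_ = sigma_sets ?\<Omega> ?E")
proof
  have sub: "?E \<subseteq> Pow ?\<Omega>"
    by (auto dest!: sets.sets_into_space)
  have "fst \<in> measurable (sigma ?\<Omega> ?E) S"
  proof (rule measurableI)
    fix A assume A: "A \<in> sets S"
    have "fst -` A \<inter> space (sigma ?\<Omega> ?E) = A \<times> space N \<times> space K"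
      using sets.sets_into_space[OF A] sub by (auto simp: space_measure_of)
    also have "\<dots> \<in> ?E" using A by blast
    finally show "fst -` A \<inter> space (sigma ?\<Omega> ?E) \<in> sets (sigma ?\<Omega> ?E)"
      using sub by auto
  qed (use sub in \<open>auto simp: space_measure_of\<close>)
  moreover have "(\<lambda>z. fst (snd z)) \<in> measurable (sigma ?\<Omega> ?E) N"
  proof (rule measurableI)
    fix C assume C: "C \<in> sets N"
    have "(\<lambda>z. fst (snd z)) -` C \<inter> space (sigma ?\<Omega> ?E) = space S \<times> C \<times> space K"
      using sets.sets_into_space[OF C] sub by (auto simp: space_measure_of)
    also have "\<dots> \<in> ?E" using C by blast
    finally show "(\<lambda>z. fst (snd z)) -` C \<inter> space (sigma ?\<Omega> ?E) \<in> sets (sigma ?\<Omega> ?E)"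
      using sub by auto
  qed (use sub in \<open>auto simp: space_measure_of\<close>)
  moreover have "(\<lambda>z. snd (snd z)) \<in> measurable (sigma ?\<Omega> ?E) K"
  proof (rule measurableI)
    fix D assume D: "D \<in> sets K"
    have "(\<lambda>z. snd (snd z)) -` D \<inter> space (sigma ?\<Omega> ?E) = space S \<times> space N \<times> D"
      using sets.sets_into_space[OF D] sub by (auto simp: space_measure_of)
    also have "\<dots> \<in> ?E" using D by blast
    finally show "(\<lambda>z. snd (snd z)) -` D \<inter> space (sigma ?\<Omega> ?E) \<in> sets (sigma ?\<Omega> ?E)"
      using sub by auto
  qed (use sub in \<open>auto simp: space_measure_of\<close>)
  ultimately have "(\<lambda>z. (fst z, fst (snd z), snd (snd z))) \<in>
      measurable (sigma ?\<Omega> ?E) (S \<Otimes>\<^sub>M N \<Otimes>\<^sub>M K)"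
    by measurable
  then have id: "(\<lambda>z. z) \<in> measurable (sigma ?\<Omega> ?E) (S \<Otimes>\<^sub>M N \<Otimes>\<^sub>M K)"
    by simp
  show "sets (S \<Otimes>\<^sub>M N \<Otimes>\<^sub>M K) \<subseteq> sigma_sets ?\<Omega> ?E"
  proof
    fix Q assume Q: "Q \<in> sets (S \<Otimes>\<^sub>M N \<Otimes>\<^sub>M K)"
    then have "Q \<subseteq> ?\<Omega>"
      using sets.sets_into_space by (fastforce simp: space_pair_measure)
    then show "Q \<in> sigma_sets ?\<Omega> ?E"
      using measurable_sets[OF id Q] sub by (simp add: space_measure_of Int_absorb2)
  qed
  have "?E \<subseteq> sets (S \<Otimes>\<^sub>M N \<Otimes>\<^sub>M K)"
    by auto
  then show "sigma_sets ?\<Omega> ?E \<subseteq> sets (S \<Otimes>\<^sub>M N \<Otimes>\<^sub>M K)"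
    using sets.sigma_sets_subset[of ?E "S \<Otimes>\<^sub>M N \<Otimes>\<^sub>M K"] by (simp add: space_pair_measure)
qed

text \<open>The defining property of conditional expectation, integrated over an event of the
  sigma-algebra generated by \<open>Z\<close>. It turns almost sure statements about conditional
  probabilities into statements about \<open>prob\<close>.\<close>

lemma (in prob_space) measure_Int_cond_prob_given:
  assumes Z: "Z \<in> measurable M S" and T: "T \<in> sets S" and E: "E \<in> events"
  shows "prob (Z -` T \<inter> space M \<inter> E) =
    (\<integral>\<omega>. indicator (Z -` T \<inter> space M) \<omega> * cond_prob_given M S Z E \<omega> \<partial>M)"
proof -
  let ?F = "vimage_algebra (space M) Z S"
  have sub: "subalgebra M ?F"
    using Z by (auto simp: subalgebra_def sets_vimage_algebra2 measurable_space)
  interpret finite_measure_subalgebra M ?F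
    by unfold_locales (rule sub)
  have [simp]: "integrable M (indicator E :: _ \<Rightarrow> real)"
    using E by (simp add: integrable_indicator_iff less_top[symmetric])
  have T': "Z -` T \<inter> space M \<in> sets ?F"
    using T by (rule in_vimage_algebra)
  then have "Z -` T \<inter> space M \<inter> E \<in> events"
    using sub E by (auto simp: subalgebra_def)
  then have "prob (Z -` T \<inter> space M \<inter> E) = (\<integral>\<omega>. indicator (Z -` T \<inter> space M \<inter> E) \<omega> \<partial>M)"
    by simp
  also have "\<dots> = (\<integral>\<omega>\<in>Z -` T \<inter> space M. indicator E \<omega> \<partial>M)"
    by (simp add: set_lebesgue_integral_def indicator_inter_arith)
  also have "\<dots> = (\<integral>\<omega>\<in>Z -` T \<inter> space M. cond_prob_given M S Z E \<omega> \<partial>M)"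
    unfolding cond_prob_given_def by (rule real_cond_exp_intA) (use T' in simp_all)
  finally show ?thesis
    by (simp add: set_lebesgue_integral_def)
qed

lemma borel_measurable_cond_prob_given [measurable]:
  "cond_prob_given M S Z E \<in> borel_measurable M"
  unfolding cond_prob_given_def by (rule borel_measurable_cond_exp2)

text \<open>An event about \<open>g (V \<omega>)\<close> is already an event about \<open>V\<close>.
  This supplies the seed condition for the permuted labels.\<close>

lemma cond_indep_var_compose:
  assumes V: "V \<in> measurable M N" and g: "g \<in> measurable N N'"
    and ci: "cond_indep_var M S Z N V K U"
  shows "cond_indep_var M S Z N' (\<lambda>\<omega>. g (V \<omega>)) K U"
  unfolding cond_indep_var_def
proof (intro ballI)
  fix C D assume C: "C \<in> sets N'" and D: "D \<in> sets K"
  have eq: "(\<lambda>\<omega>. g (V \<omega>)) -` C \<inter> space M = V -` (g -` C \<inter> space N) \<inter> space M"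
    using measurable_space[OF V] by auto
  show "AE \<omega> in M. cond_prob_given M S Z ((\<lambda>\<omega>. g (V \<omega>)) -` C \<inter> space M \<inter> (U -` D \<inter> space M)) \<omega> =
      cond_prob_given M S Z ((\<lambda>\<omega>. g (V \<omega>)) -` C \<inter> space M) \<omega> *
      cond_prob_given M S Z (U -` D \<inter> space M) \<omega>"
    using ci measurable_sets[OF g C] D unfolding cond_indep_var_def eq by blast
qed

text \<open>Given \<open>Z\<close>, conditional independence factorises the joint conditional law of \<open>(V, U)\<close>, so it
  is determined by the conditional laws of \<open>V\<close> and \<open>U\<close>.\<close>

lemma (in prob_space) distr_triple_eq:
  assumes Z: "Z \<in> measurable M S" and V: "V \<in> measurable M N" and V': "V' \<in> measurable M N"
    and U: "U \<in> measurable M K"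
    and ci: "cond_indep_var M S Z N V K U" and ci': "cond_indep_var M S Z N V' K U"
    and eq: "cond_distr_eq M S Z N V V'"
  shows "distr M (S \<Otimes>\<^sub>M N \<Otimes>\<^sub>M K) (\<lambda>\<omega>. (Z \<omega>, V \<omega>, U \<omega>)) =
    distr M (S \<Otimes>\<^sub>M N \<Otimes>\<^sub>M K) (\<lambda>\<omega>. (Z \<omega>, V' \<omega>, U \<omega>))"
proof -
  note [measurable] = Z V V' U
  let ?\<Omega> = "space S \<times> space N \<times> space K"
  let ?E = "{A \<times> C \<times> D | A C D. A \<in> sets S \<and> C \<in> sets N \<and> D \<in> sets K}"
  have prob_eq: "emeasure (distr M (S \<Otimes>\<^sub>M N \<Otimes>\<^sub>M K) (\<lambda>\<omega>. (Z \<omega>, V \<omega>, U \<omega>))) (A \<times> C \<times> D) =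
      emeasure (distr M (S \<Otimes>\<^sub>M N \<Otimes>\<^sub>M K) (\<lambda>\<omega>. (Z \<omega>, V' \<omega>, U \<omega>))) (A \<times> C \<times> D)"
    if [measurable]: "A \<in> sets S" "C \<in> sets N" "D \<in> sets K" for A C D
  proof -
    let ?c = "cond_prob_given M S Z"
    \<comment> \<open>Kept generic in \<open>R\<close> to serve both \<open>V\<close> and
      \<open>V'\<close>: the resulting integrands differ only in the conditional probability of the
      \<open>C\<close>-event.\<close>
    have factor: "prob (Z -` A \<inter> space M \<inter> (R -` C \<inter> space M \<inter> (U -` D \<inter> space M))) =
        (\<integral>\<omega>. indicator (Z -` A \<inter> space M) \<omega> *
          (?c (R -` C \<inter> space M) \<omega> * ?c (U -` D \<inter> space M) \<omega>) \<partial>M)"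
      if [measurable]: "R \<in> measurable M N" and ciR: "cond_indep_var M S Z N R K U" for R
    proof -
      have "AE \<omega> in M. ?c (R -` C \<inter> space M \<inter> (U -` D \<inter> space M)) \<omega> =
          ?c (R -` C \<inter> space M) \<omega> * ?c (U -` D \<inter> space M) \<omega>"
        using ciR \<open>C \<in> sets N\<close> \<open>D \<in> sets K\<close> unfolding cond_indep_var_def by blast
      then show ?thesis
        by (subst measure_Int_cond_prob_given) (measurable, auto intro!: integral_cong_AE)
    qed
    have "AE \<omega> in M. ?c (V -` C \<inter> space M) \<omega> = ?c (V' -` C \<inter> space M) \<omega>"
      using eq \<open>C \<in> sets N\<close> unfolding cond_distr_eq_def by blast
    then have "prob (Z -` A \<inter> space M \<inter> (V -` C \<inter> space M \<inter> (U -` D \<inter> space M))) =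
        prob (Z -` A \<inter> space M \<inter> (V' -` C \<inter> space M \<inter> (U -` D \<inter> space M)))"
      unfolding factor[OF V ci] factor[OF V' ci'] by (intro integral_cong_AE) auto
    moreover have "(\<lambda>\<omega>. (Z \<omega>, R \<omega>, U \<omega>)) -` (A \<times> C \<times> D) \<inter> space M =
        Z -` A \<inter> space M \<inter> (R -` C \<inter> space M \<inter> (U -` D \<inter> space M))" for R :: "_ \<Rightarrow> 'c"
      by auto
    ultimately show ?thesis
      by (simp add: emeasure_distr emeasure_eq_measure)
  qed
  show ?thesis
  \<comment> \<open>The whole space is itself a box of finite measure, so a constant sequence is an
    admissible exhaustion.\<close>
  proof (rule measure_eqI_generator_eq[where E = ?E and \<Omega> = ?\<Omega> and A = "\<lambda>_. ?\<Omega>"])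
    show "Int_stable ?E"
    proof (rule Int_stableI)
      fix a b assume "a \<in> ?E" "b \<in> ?E"
      then obtain A C D A' C' D' where
        "a = A \<times> C \<times> D" "b = A' \<times> C' \<times> D'" and
        "A \<in> sets S" "C \<in> sets N" "D \<in> sets K" "A' \<in> sets S" "C' \<in> sets N" "D' \<in> sets K"
        by blast
      moreover from this have "a \<inter> b = (A \<inter> A') \<times> (C \<inter> C') \<times> (D \<inter> D')" by blast
      ultimately show "a \<inter> b \<in> ?E" by blast
    qed
    show "?E \<subseteq> Pow ?\<Omega>"
      by (auto dest!: sets.sets_into_space)
    interpret P: prob_space "distr M (S \<Otimes>\<^sub>M N \<Otimes>\<^sub>M K) (\<lambda>\<omega>. (Z \<omega>, V \<omega>, U \<omega>))"
      by (rule prob_space_distr) measurable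
    show "emeasure (distr M (S \<Otimes>\<^sub>M N \<Otimes>\<^sub>M K) (\<lambda>\<omega>. (Z \<omega>, V \<omega>, U \<omega>))) ?\<Omega> \<noteq> \<infinity>"
      by (simp add: P.emeasure_eq_measure)
  qed (auto simp: sets_triple_measure intro: prob_eq)
qed

section \<open>Counting indices whose statistic is rarely reached\<close>

text \<open>Call an index good if at most \<open>r\<close> statistics, its own included, reach its
  value. The smallest good statistic is reached by every good index, so the number of good indices
  is at most its count, hence at most \<open>r\<close>.\<close>

lemma sum_card_ge_le:
  fixes t :: "'i \<Rightarrow> 'b :: linorder" and r :: real
  assumes J: "finite J" and r: "0 \<le> r"
  shows "(\<Sum>j\<in>J. of_bool ((\<Sum>b\<in>J. of_bool (t b \<ge> t j)) \<le> r)) \<le> r"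
proof -
  define I where "I = {j \<in> J. real (card {b \<in> J. t b \<ge> t j}) \<le> r}"
  have "finite I" using J by (simp add: I_def)
  have "real (card I) \<le> r"
  proof (cases "I = {}")
    case False
    have "Min (t ` I) \<in> t ` I"
      using \<open>finite I\<close> False by (intro Min_in) auto
    then obtain j where j: "j \<in> I" "t j = Min (t ` I)" by auto
    then have "I \<subseteq> {b \<in> J. t b \<ge> t j}"
      using \<open>finite I\<close> by (auto simp: I_def)
    then have "card I \<le> card {b \<in> J. t b \<ge> t j}"
      using J by (intro card_mono) auto
    also have "real \<dots> \<le> r" using j by (simp add: I_def)
    finally show ?thesis by simp
  qed (use r in simp)
  then show ?thesis
    using J by (simp add: I_def of_bool_def sum.If_cases Int_def)
qed

text \<open>The counting bound holds at every outcome and is integrated, whatever the dependence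
  between the statistics.\<close>

lemma (in prob_space) sum_prob_card_ge_le:
  fixes t :: "'i \<Rightarrow> 'a \<Rightarrow> real" and r :: real
  assumes J: "finite J" and r: "0 \<le> r"
    and [measurable]: "\<And>j. j \<in> J \<Longrightarrow> t j \<in> borel_measurable M"
  shows "(\<Sum>j\<in>J. prob {\<omega> \<in> space M. (\<Sum>b\<in>J. of_bool (t b \<omega> \<ge> t j \<omega>)) \<le> r}) \<le> r"
proof -
  let ?E = "\<lambda>j. {\<omega> \<in> space M. (\<Sum>b\<in>J. of_bool (t b \<omega> \<ge> t j \<omega>)) \<le> r}"
  have [measurable]: "?E j \<in> events" if "j \<in> J" for j
    unfolding of_bool_def using that by measurable
  have int: "integrable M (indicator (?E j) :: _ \<Rightarrow> real)" if "j \<in> J" for j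
    using that by (simp add: integrable_indicator_iff less_top[symmetric])
  have "(\<Sum>j\<in>J. prob (?E j)) = (\<Sum>j\<in>J. expectation (indicator (?E j)))"
    by (intro sum.cong) auto
  also have "\<dots> = expectation (\<lambda>\<omega>. \<Sum>j\<in>J. indicator (?E j) \<omega>)"
    using int by (subst Bochner_Integration.integral_sum) auto
  also have "\<dots> \<le> expectation (\<lambda>_. r)"
  proof (rule integral_mono)
    fix \<omega> assume "\<omega> \<in> space M"
    then show "(\<Sum>j\<in>J. indicator (?E j) \<omega>) \<le> r"
      using sum_card_ge_le[OF J r, of "\<lambda>j. t j \<omega>"] by (simp add: indicator_def of_bool_def)
  qed (use int in auto)
  finally show ?thesis by (simp add: prob_space)
qed

section \<open>Reindexing tuples of permutations\<close>

text \<open>The tuple \<open>(id, f\<^sub>1, \<dots>, f\<^sub>B)\<close> of relabellings, with \<open>id\<close> for the observed data, is encoded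
  as \<open>f(0 := id)\<close>; the map \<open>(\<tau>, f) \<mapsto> (\<tau>, \<tau> \<circ> f\<^sub>1, \<dots>, \<tau> \<circ> f\<^sub>B)\<close> is a bijection.\<close>

lemma sum_PiE_left_translate:
  fixes G :: "(nat \<Rightarrow> 'i \<Rightarrow> 'i) \<Rightarrow> real"
  assumes cong: "\<And>g h. (\<And>b. b \<le> B \<Longrightarrow> g b = h b) \<Longrightarrow> G g = G h"
  shows "(\<Sum>(\<tau>, f)\<in>{\<sigma>. \<sigma> permutes I} \<times> ({1..B} \<rightarrow>\<^sub>E {\<sigma>. \<sigma> permutes I}).
      G (\<lambda>b. \<tau> \<circ> (f(0 := id)) b)) = (\<Sum>g\<in>{0..B} \<rightarrow>\<^sub>E {\<sigma>. \<sigma> permutes I}. G g)"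
    (is "sum _ (?S \<times> ?F) = sum _ ?G")
\<comment> \<open>Slot 0 of the image is \<open>\<tau> \<circ> id\<close>, so \<open>\<tau>\<close>
  is read off there and cancelled from the left in the other slots.\<close>
proof (rule sum.reindex_bij_witness[where
      i = "\<lambda>g. (g 0, \<lambda>b\<in>{1..B}. inv (g 0) \<circ> g b)" and
      j = "\<lambda>(\<tau>, f). \<lambda>b\<in>{0..B}. \<tau> \<circ> (f(0 := id)) b"])
  fix q assume q: "q \<in> ?S \<times> ?F"
  then obtain \<tau> f where [simp]: "q = (\<tau>, f)" and \<tau>: "\<tau> permutes I" and f: "f \<in> ?F"
    by auto
  have "(\<lambda>b\<in>{1..B}. inv \<tau> \<circ> (\<tau> \<circ> f b)) = f"
    using f by (auto simp: fun_eq_iff permutes_inverses[OF \<tau>] PiE_def extensional_def)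
  moreover have "(\<lambda>b\<in>{1..B}. inv \<tau> \<circ> (\<lambda>b\<in>{0..B}. \<tau> \<circ> (f(0 := id)) b) b) =
      (\<lambda>b\<in>{1..B}. inv \<tau> \<circ> (\<tau> \<circ> f b))"
    by (intro restrict_ext) auto
  ultimately show "(\<lambda>g. (g 0, \<lambda>b\<in>{1..B}. inv (g 0) \<circ> g b))
      ((\<lambda>(\<tau>, f). \<lambda>b\<in>{0..B}. \<tau> \<circ> (f(0 := id)) b) q) = q"
    by simp
  have "\<tau> \<circ> (f(0 := id)) b permutes I" if "b \<le> B" for b
    using \<tau> f that by (cases "b = 0") (auto intro!: permutes_compose)
  then show "(\<lambda>(\<tau>, f). \<lambda>b\<in>{0..B}. \<tau> \<circ> (f(0 := id)) b) q \<in> ?G"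
    by (auto simp del: fun_upd_apply)
  \<comment> \<open>\<open>G\<close> sees only the slots 0 to \<open>B\<close>, so restricting the
    tuple to them does not change its value.\<close>
  show "G ((\<lambda>(\<tau>, f). \<lambda>b\<in>{0..B}. \<tau> \<circ> (f(0 := id)) b) q) =
      (\<lambda>(\<tau>, f). G (\<lambda>b. \<tau> \<circ> (f(0 := id)) b)) q"
    by (auto intro: cong)
next
  fix g assume g: "g \<in> ?G"
  then have g0: "g 0 permutes I" by auto
  have "inv (g 0) \<circ> g b permutes I" if "b \<in> {1..B}" for b
    using g that by (intro permutes_compose permutes_inv g0) auto
  then show "(g 0, \<lambda>b\<in>{1..B}. inv (g 0) \<circ> g b) \<in> ?S \<times> ?F"
    using g0 by auto
  show "(\<lambda>(\<tau>, f). \<lambda>b\<in>{0..B}. \<tau> \<circ> (f(0 := id)) b) (g 0, \<lambda>b\<in>{1..B}. inv (g 0) \<circ> g b) = g"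
    using g by (auto simp: fun_eq_iff permutes_inverses[OF g0] PiE_def extensional_def)
qed

text \<open>The transposition is its own inverse, so composing with it is an involution on tuples;
  \<open>j \<le> B\<close> keeps the slots beyond \<open>B\<close> undefined.\<close>

lemma sum_PiE_swap:
  assumes "j \<le> B"
  shows "(\<Sum>g\<in>{0..B::nat} \<rightarrow>\<^sub>E S. G (g \<circ> Transposition.transpose 0 j)) = (\<Sum>g\<in>{0..B} \<rightarrow>\<^sub>E S. G g)"
proof -
  have "g \<circ> Transposition.transpose 0 j \<in> {0..B} \<rightarrow>\<^sub>E S" if "g \<in> {0..B} \<rightarrow>\<^sub>E S" for g
    using that assms by (auto simp: PiE_iff extensional_def Transposition.transpose_def)
  then show ?thesis
    by (intro sum.reindex_bij_witness[where i = "\<lambda>g. g \<circ> Transposition.transpose 0 j" and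
          j = "\<lambda>g. g \<circ> Transposition.transpose 0 j"]) (auto simp: comp_assoc)
qed

section \<open>The p-value as a rank, and the action on labels\<close>

text \<open>The \<open>1\<close> in the numerator is the observed statistic compared with itself, so
  the p-value is a normalised rank among \<open>B + 1\<close> statistics.\<close>

lemma permutation_p_value_le_iff:
  "permutation_p_value B (t 0) t \<le> \<alpha> \<longleftrightarrow>
    (\<Sum>b\<in>{0..B}. of_bool (t b \<ge> t 0)) \<le> \<alpha> * (real B + 1)"
proof -
  have "(\<Sum>b\<in>{0..B}. of_bool (t b \<ge> t 0)) = 1 + (\<Sum>b=1..B. of_bool (t b \<ge> t 0) :: real)"
    by (simp add: sum.atLeast_Suc_atMost del: sum_of_bool_eq)
  then show ?thesis
    by (simp add: permutation_p_value_def pos_divide_le_eq)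
qed

lemma permute_labels_id: "l \<in> space (labels_space n L) \<Longrightarrow> permute_labels n id l = l"
  by (auto simp: permute_labels_def labels_space_def space_PiM PiE_def extensional_def fun_eq_iff)

text \<open>A right action, hence the reversed order of composition. The outer permutation keeps
  indices inside \<open>{1..n}\<close>, where the inner restriction takes genuine values.\<close>

lemma permute_labels_comp:
  assumes "\<sigma> permutes {1..n}"
  shows "permute_labels n \<sigma> (permute_labels n \<tau> l) = permute_labels n (\<tau> \<circ> \<sigma>) l"
  using permutes_in_image[OF assms] by (auto simp: permute_labels_def fun_eq_iff)

lemma measurable_permute_labels:
  assumes "\<sigma> permutes {1..n}"
  shows "permute_labels n \<sigma> \<in> measurable (labels_space n L) (labels_space n L)"
  unfolding permute_labels_def labels_space_def
  using permutes_in_image[OF assms]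
  by (intro measurable_restrict measurable_component_singleton) auto

theorem proposition3p1:
  fixes M :: "'a measure" and W :: "'w measure" and L :: "'l measure" and K :: "'u measure"
    and n B :: nat
    and X :: "'a \<Rightarrow> nat \<Rightarrow> 'w list" and y :: "'a \<Rightarrow> nat \<Rightarrow> 'l" and U :: "'a \<Rightarrow> 'u"
    and A :: "(nat \<Rightarrow> 'w list) \<Rightarrow> (nat \<Rightarrow> 'l) \<Rightarrow> 'u \<Rightarrow> real"
    and \<pi> :: "nat \<Rightarrow> 'a \<Rightarrow> nat \<Rightarrow> nat"
    and \<alpha> :: real
  assumes prob: "prob_space M"
    and n: "n \<ge> 1" and B: "B \<ge> 1"
    and X: "X \<in> measurable M (histories_space n W)"
    and y: "y \<in> measurable M (labels_space n L)"
    and U: "U \<in> measurable M K"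
    and A: "(\<lambda>(x, l, u). A x l u) \<in>
      borel_measurable (histories_space n W \<Otimes>\<^sub>M labels_space n L \<Otimes>\<^sub>M K)"
    and seed: "cond_indep_var M (histories_space n W) X (labels_space n L) y K U"
    and exchangeable: "\<And>\<sigma>. \<sigma> permutes {1..n} \<Longrightarrow>
      cond_distr_eq M (histories_space n W) X (labels_space n L)
        (\<lambda>\<omega>. permute_labels n \<sigma> (y \<omega>)) y"
    and perms_indep: "prob_space.indep_vars M (\<lambda>_. perms_space n) \<pi> {1..B}"
    and perms_uniform: "\<And>b. b \<in> {1..B} \<Longrightarrow>
      distr M (perms_space n) (\<pi> b) = uniform_count_measure {\<sigma>. \<sigma> permutes {1..n}}"
    and perms_indep_data: "prob_space.indep_set M
      (sets (vimage_algebra (space M) (\<lambda>\<omega>. (X \<omega>, y \<omega>, U \<omega>))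
        (histories_space n W \<Otimes>\<^sub>M labels_space n L \<Otimes>\<^sub>M K)))
      (sets (vimage_algebra (space M) (\<lambda>\<omega>. \<lambda>b\<in>{1..B}. \<pi> b \<omega>)
        (PiM {1..B} (\<lambda>_. perms_space n))))"
    and \<alpha>: "0 < \<alpha>" "\<alpha> < 1"
  shows "measure M {\<omega> \<in> space M.
      permutation_p_value B (A (X \<omega>) (y \<omega>) (U \<omega>))
        (\<lambda>b. A (X \<omega>) (permute_labels n (\<pi> b \<omega>) (y \<omega>)) (U \<omega>)) \<le> \<alpha>} \<le> \<alpha>"
proof -
  interpret prob_space M by (rule prob)
  let ?S = "{\<sigma>. \<sigma> permutes {1..n}}"
  let ?HS = "histories_space n W" and ?LS = "labels_space n L"
  let ?F = "{1..B} \<rightarrow>\<^sub>E ?S"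

  \<comment> \<open>Rank events and their invariance under relabelling\<close>
  define N where "N = real (card ?S)"
  define r where "r = \<alpha> * (real B + 1)"
  define a where "a \<sigma> \<omega> = A (X \<omega>) (permute_labels n \<sigma> (y \<omega>)) (U \<omega>)" for \<sigma> \<omega>
  \<comment> \<open>Rejection will be the case \<open>j = 0\<close> with \<open>g 0 = id\<close>.
    \<open>Q\<close> is the counterpart of \<open>E\<close> on the space of data values, which
    allows a change of law.\<close>
  define E where "E g j = {\<omega> \<in> space M. (\<Sum>b\<in>{0..B}. of_bool (a (g b) \<omega> \<ge> a (g j) \<omega>)) \<le> r}"
    for g :: "nat \<Rightarrow> nat \<Rightarrow> nat" and j
  define Q where "Q g j = {z \<in> space (?HS \<Otimes>\<^sub>M ?LS \<Otimes>\<^sub>M K).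
      (\<Sum>b\<in>{0..B}. of_bool (A (fst z) (permute_labels n (g b) (fst (snd z))) (snd (snd z)) \<ge>
        A (fst z) (permute_labels n (g j) (fst (snd z))) (snd (snd z)))) \<le> r}"
    for g :: "nat \<Rightarrow> nat \<Rightarrow> nat" and j
  have finS: "finite ?S" by (simp add: finite_permutations)
  have "id \<in> ?S" by simp
  then have N: "N > 0"
    using finS unfolding N_def by (metis card_gt_0_iff empty_iff of_nat_0_less_iff)
  have r: "r \<ge> 0" using \<alpha> by (simp add: r_def)
  note [measurable] = X y U
  have perm_meas: "permute_labels n \<sigma> \<in> measurable ?LS ?LS" if "\<sigma> \<in> ?S" for \<sigma>
    using that by (simp add: measurable_permute_labels)
  have A_perm: "(\<lambda>z. A (fst z) (permute_labels n \<sigma> (fst (snd z))) (snd (snd z))) \<in>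
      borel_measurable (?HS \<Otimes>\<^sub>M ?LS \<Otimes>\<^sub>M K)" if "\<sigma> \<in> ?S" for \<sigma>
  proof -
    note [measurable] = perm_meas[OF that]
    have "(\<lambda>z. (fst z, permute_labels n \<sigma> (fst (snd z)), snd (snd z))) \<in>
        measurable (?HS \<Otimes>\<^sub>M ?LS \<Otimes>\<^sub>M K) (?HS \<Otimes>\<^sub>M ?LS \<Otimes>\<^sub>M K)"
      by measurable
    from measurable_compose[OF this A] show ?thesis
      by (simp add: case_prod_unfold)
  qed
  have Q: "Q g j \<in> sets (?HS \<Otimes>\<^sub>M ?LS \<Otimes>\<^sub>M K)" if "\<And>b. b \<le> B \<Longrightarrow> g b \<in> ?S" "j \<le> B" for g j
  proof -
    have [measurable]: "(\<lambda>z. A (fst z) (permute_labels n (g b) (fst (snd z))) (snd (snd z))) \<in>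
        borel_measurable (?HS \<Otimes>\<^sub>M ?LS \<Otimes>\<^sub>M K)" if "b \<in> {0..B}" for b
      using A_perm[of "g b"] \<open>\<And>b. b \<le> B \<Longrightarrow> g b \<in> ?S\<close> that by simp
    have [measurable]: "j \<in> {0..B}" using that(2) by simp
    show ?thesis
      unfolding Q_def of_bool_def by measurable
  qed
  have D: "(\<lambda>\<omega>. (X \<omega>, permute_labels n \<tau> (y \<omega>), U \<omega>)) \<in> measurable M (?HS \<Otimes>\<^sub>M ?LS \<Otimes>\<^sub>M K)"
    if "\<tau> \<in> ?S" for \<tau>
  proof -
    note [measurable] = perm_meas[OF that]
    show ?thesis by measurable
  qed
  \<comment> \<open>Applying \<open>g b\<close> to labels already permuted by \<open>\<tau>\<close>
    is applying \<open>\<tau> \<circ> g b\<close> to the original ones, so left translation of the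
    tuple becomes a change of the data.\<close>
  have E_eq: "E (\<lambda>b. \<tau> \<circ> g b) j = (\<lambda>\<omega>. (X \<omega>, permute_labels n \<tau> (y \<omega>), U \<omega>)) -` Q g j \<inter> space M"
    if "\<tau> \<in> ?S" "\<And>b. b \<le> B \<Longrightarrow> g b \<in> ?S" "j \<le> B" for \<tau> g j
    using measurable_space[OF D[OF that(1)]] that
    by (auto simp: E_def Q_def a_def permute_labels_comp simp del: sum_of_bool_eq)
  have y_id: "permute_labels n id (y \<omega>) = y \<omega>" if "\<omega> \<in> space M" for \<omega>
    using measurable_space[OF y that] by (rule permute_labels_id)
  have E_id: "E g j = (\<lambda>\<omega>. (X \<omega>, y \<omega>, U \<omega>)) -` Q g j \<inter> space M"
    if "\<And>b. b \<le> B \<Longrightarrow> g b \<in> ?S" "j \<le> B" for g j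
    using E_eq[of id g j] that y_id by (auto cong: conj_cong)
  \<comment> \<open>The permuted labels have the conditional law of \<open>y\<close> by
    exchangeability and, as a function of \<open>y\<close>, stay conditionally independent of the
    seed.\<close>
  have law: "distr M (?HS \<Otimes>\<^sub>M ?LS \<Otimes>\<^sub>M K) (\<lambda>\<omega>. (X \<omega>, permute_labels n \<tau> (y \<omega>), U \<omega>)) =
      distr M (?HS \<Otimes>\<^sub>M ?LS \<Otimes>\<^sub>M K) (\<lambda>\<omega>. (X \<omega>, y \<omega>, U \<omega>))" if "\<tau> \<in> ?S" for \<tau>
    using that X y U perm_meas[OF that] measurable_compose[OF y perm_meas[OF that]]
    by (intro distr_triple_eq cond_indep_var_compose[OF y _ seed] seed exchangeable) simp_all
  have invariant: "prob (E (\<lambda>b. \<tau> \<circ> g b) j) = prob (E g j)"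
    if "\<tau> \<in> ?S" "\<And>b. b \<le> B \<Longrightarrow> g b \<in> ?S" "j \<le> B" for \<tau> g j
  proof -
    have "prob (E (\<lambda>b. \<tau> \<circ> g b) j) =
        measure (distr M (?HS \<Otimes>\<^sub>M ?LS \<Otimes>\<^sub>M K) (\<lambda>\<omega>. (X \<omega>, permute_labels n \<tau> (y \<omega>), U \<omega>))) (Q g j)"
      using E_eq[of \<tau> g j] that D Q by (simp add: measure_distr)
    also have "\<dots> = prob (E g j)"
      unfolding law[OF that(1)] using E_id[of g j] that Q by (simp add: measure_distr)
    finally show ?thesis .
  qed
  have E_cong: "E g j = E h j" if "\<And>b. b \<le> B \<Longrightarrow> g b = h b" "j \<le> B" for g h j
    using that by (simp add: E_def del: sum_of_bool_eq)

  \<comment> \<open>Distribution of the drawn permutations\<close>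
  have \<pi>: "\<pi> b \<omega> \<in> ?S" if "b \<in> {1..B}" "\<omega> \<in> space M" for b \<omega>
    using perms_indep that unfolding indep_vars_def perms_space_def
    by (auto dest!: measurable_space)
  define R where "R f = {\<omega> \<in> space M. (\<lambda>b\<in>{1..B}. \<pi> b \<omega>) = f}" for f
  have R_sets: "R f \<in> sets (vimage_algebra (space M) (\<lambda>\<omega>. \<lambda>b\<in>{1..B}. \<pi> b \<omega>)
      (PiM {1..B} (\<lambda>_. perms_space n)))" if f: "f \<in> ?F" for f
  proof -
    have "PiE {1..B} (\<lambda>b. {f b}) \<in> sets (PiM {1..B} (\<lambda>_. perms_space n))"
      using f by (intro sets_PiM_I_finite) (auto simp: perms_space_def)
    moreover have "PiE {1..B} (\<lambda>b. {f b}) = {f}"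
      using f by (intro PiE_singleton) (simp add: PiE_def)
    moreover have "R f = (\<lambda>\<omega>. \<lambda>b\<in>{1..B}. \<pi> b \<omega>) -` {f} \<inter> space M"
      by (auto simp: R_def)
    ultimately show ?thesis
      by (metis in_vimage_algebra)
  qed
  have R_ev: "R f \<in> events" if "f \<in> ?F" for f
    using R_sets[OF that] perms_indep_data unfolding indep_set_def indep_sets_def
    by (auto split: bool.splits)
  \<comment> \<open>With \<open>g\<close> fixed, \<open>E g 0\<close> is an event of the data alone
    and so independent of the draws; this is the reason for splitting over the values
    \<open>f\<close>.\<close>
  have R_indep: "prob (E g 0 \<inter> R f) = prob (E g 0) * prob (R f)"
    if "f \<in> ?F" "\<And>b. b \<le> B \<Longrightarrow> g b \<in> ?S" for f g
  proof (rule indep_setD[OF perms_indep_data])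
    show "E g 0 \<in> sets (vimage_algebra (space M) (\<lambda>\<omega>. (X \<omega>, y \<omega>, U \<omega>)) (?HS \<Otimes>\<^sub>M ?LS \<Otimes>\<^sub>M K))"
      using E_id[of g 0] Q[of g 0] that(2) by (simp add: in_vimage_algebra)
  qed (rule R_sets[OF that(1)])
  have R_prob: "prob (R f) = 1 / N ^ B" if f: "f \<in> ?F" for f
  proof -
    have "(\<lambda>b\<in>{1..B}. \<pi> b \<omega>) = f \<longleftrightarrow> (\<forall>b\<in>{1..B}. \<pi> b \<omega> = f b)" for \<omega>
    proof
      assume "\<forall>b\<in>{1..B}. \<pi> b \<omega> = f b"
      then have "(\<lambda>b\<in>{1..B}. \<pi> b \<omega>) = restrict f {1..B}"
        by (intro restrict_ext) auto
      also have "\<dots> = f"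
        using f by (intro extensional_restrict) (simp add: PiE_def)
      finally show "(\<lambda>b\<in>{1..B}. \<pi> b \<omega>) = f" .
    qed auto
    \<comment> \<open>\<open>B \<ge> 1\<close> matters: an empty intersection would be the whole
      type instead of the sample space.\<close>
    then have "R f = (\<Inter>b\<in>{1..B}. \<pi> b -` {f b} \<inter> space M)"
      using B by (auto simp: R_def)
    also have "prob \<dots> = (\<Prod>b\<in>{1..B}. prob (\<pi> b -` {f b} \<inter> space M))"
      using f B by (intro indep_varsD[OF perms_indep]) (auto simp: perms_space_def)
    also have "\<dots> = (\<Prod>b\<in>{1..B}. 1 / N)"
    proof (intro prod.cong refl)
      fix b assume b: "b \<in> {1..B}"
      have "prob (\<pi> b -` {f b} \<inter> space M) = measure (distr M (perms_space n) (\<pi> b)) {f b}"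
        using perms_indep b f by (subst measure_distr) (auto simp: indep_vars_def perms_space_def)
      also have "\<dots> = 1 / N"
        unfolding perms_uniform[OF b] N_def using f b finS
        by (subst measure_uniform_count_measure) auto
      finally show "prob (\<pi> b -` {f b} \<inter> space M) = 1 / N" .
    qed
    finally show ?thesis by (simp add: power_divide)
  qed

  \<comment> \<open>Rejection split over the values of the draws\<close>
  let ?P = "{\<omega> \<in> space M. permutation_p_value B (A (X \<omega>) (y \<omega>) (U \<omega>))
      (\<lambda>b. A (X \<omega>) (permute_labels n (\<pi> b \<omega>) (y \<omega>)) (U \<omega>)) \<le> \<alpha>}"
  \<comment> \<open>On \<open>R f\<close> the draws are the constants \<open>f\<close>, and slot 0
    gives the observed statistic because \<open>id\<close> leaves the labels unchanged.\<close>
  have in_P: "\<omega> \<in> ?P \<longleftrightarrow> \<omega> \<in> E (f(0 := id)) 0" if \<omega>: "\<omega> \<in> R f" for \<omega> f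
  proof -
    let ?t = "\<lambda>b. a ((f(0 := id)) b) \<omega>"
    have "\<omega> \<in> space M" and f: "f b = \<pi> b \<omega>" if "b \<in> {1..B}" for b
      using \<omega> that by (auto simp: R_def)
    then have "permutation_p_value B (A (X \<omega>) (y \<omega>) (U \<omega>))
        (\<lambda>b. A (X \<omega>) (permute_labels n (\<pi> b \<omega>) (y \<omega>)) (U \<omega>)) =
      permutation_p_value B (?t 0) ?t"
      using B y_id[of \<omega>] unfolding permutation_p_value_def
      by (auto simp: a_def simp del: sum_of_bool_eq intro!: sum.cong)
    then show ?thesis
      using permutation_p_value_le_iff[of B ?t \<alpha>] by (simp add: E_def r_def del: sum_of_bool_eq)
  qed
  have id_S: "(f(0 := id)) b \<in> ?S" if "f \<in> ?F" "b \<le> B" for f b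
    using that by (cases "b = 0") auto
  have finF: "finite ?F" using finS by (intro finite_PiE) auto
  have P_UN: "?P = (\<Union>f\<in>?F. E (f(0 := id)) 0 \<inter> R f)"
  proof (intro set_eqI iffI)
    fix \<omega> assume \<omega>: "\<omega> \<in> ?P"
    then have "\<omega> \<in> R (\<lambda>b\<in>{1..B}. \<pi> b \<omega>)" by (simp add: R_def)
    moreover have "(\<lambda>b\<in>{1..B}. \<pi> b \<omega>) \<in> ?F" using \<pi> \<omega> by auto
    ultimately show "\<omega> \<in> (\<Union>f\<in>?F. E (f(0 := id)) 0 \<inter> R f)"
      using in_P \<omega> by blast
  qed (use in_P in blast)
  have "prob ?P = (\<Sum>f\<in>?F. prob (E (f(0 := id)) 0 \<inter> R f))"
    unfolding P_UN
  proof (rule finite_measure_finite_Union[OF finF])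
    show "disjoint_family_on (\<lambda>f. E (f(0 := id)) 0 \<inter> R f) ?F"
      by (auto simp: disjoint_family_on_def R_def)
    have "E (f(0 := id)) 0 \<in> events" if "f \<in> ?F" for f
      using E_id[of "f(0 := id)" 0] Q[of "f(0 := id)" 0] id_S[OF that] D[of id]
      by (auto simp del: fun_upd_apply intro!: measurable_sets)
    then show "(\<lambda>f. E (f(0 := id)) 0 \<inter> R f) ` ?F \<subseteq> events"
      using R_ev by (auto simp del: fun_upd_apply)
  qed
  \<comment> \<open>Independence separates the data from the draws, and all values of the draws
    carry the same weight.\<close>
  also have "\<dots> = (\<Sum>f\<in>?F. prob (E (f(0 := id)) 0)) / N ^ B"
    unfolding sum_divide_distrib
  proof (intro sum.cong refl)
    fix f assume f: "f \<in> ?F"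
    have "prob (E (f(0 := id)) 0 \<inter> R f) = prob (E (f(0 := id)) 0) * prob (R f)"
      by (intro R_indep f id_S)
    then show "prob (E (f(0 := id)) 0 \<inter> R f) = prob (E (f(0 := id)) 0) / N ^ B"
      by (simp add: R_prob[OF f])
  qed
  finally have P_eq: "prob ?P = (\<Sum>f\<in>?F. prob (E (f(0 := id)) 0)) / N ^ B" .

  \<comment> \<open>Averaging over relabellings and over slots\<close>
  let ?G = "{0..B} \<rightarrow>\<^sub>E ?S"
  \<comment> \<open>Left translation leaves each probability unchanged, so summing over all
    \<open>\<tau>\<close> multiplies by \<open>N\<close>; in exchange, slot 0 is no longer tied to
    \<open>id\<close>.\<close>
  have "N * (\<Sum>f\<in>?F. prob (E (f(0 := id)) 0)) =
      (\<Sum>\<tau>\<in>?S. \<Sum>f\<in>?F. prob (E (\<lambda>b. \<tau> \<circ> (f(0 := id)) b) 0))"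
  proof -
    have "(\<Sum>f\<in>?F. prob (E (\<lambda>b. \<tau> \<circ> (f(0 := id)) b) 0)) = (\<Sum>f\<in>?F. prob (E (f(0 := id)) 0))"
      if "\<tau> \<in> ?S" for \<tau>
      by (intro sum.cong refl invariant that id_S le0)
    then have "(\<Sum>\<tau>\<in>?S. \<Sum>f\<in>?F. prob (E (\<lambda>b. \<tau> \<circ> (f(0 := id)) b) 0)) =
        (\<Sum>\<tau>\<in>?S. \<Sum>f\<in>?F. prob (E (f(0 := id)) 0))"
      by (rule sum.cong[OF refl])
    then show ?thesis
      by (simp only: N_def sum_constant)
  qed
  also have "\<dots> = (\<Sum>g\<in>?G. prob (E g 0))"
    unfolding sum.cartesian_product
    by (rule sum_PiE_left_translate) (simp cong: E_cong)
  finally have translate: "N * (\<Sum>f\<in>?F. prob (E (f(0 := id)) 0)) = (\<Sum>g\<in>?G. prob (E g 0))" .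
  \<comment> \<open>Over all tuples the slots are interchangeable: swapping 0 and \<open>j\<close>
    moves the reference statistic to slot \<open>j\<close> and merely reorders the count.\<close>
  have swap: "(\<Sum>g\<in>?G. prob (E g j)) = (\<Sum>g\<in>?G. prob (E g 0))" if j: "j \<in> {0..B}" for j
  proof -
    have "E (g \<circ> Transposition.transpose 0 j) 0 = E g j" for g
    proof -
      have "Transposition.transpose 0 j permutes {0..B}"
        using j by (intro permutes_swap_id) auto
      from sum.permute[OF this, of "\<lambda>b. of_bool (a (g b) \<omega> \<ge> a (g j) \<omega>) :: real" for \<omega>]
      have "(\<Sum>b\<in>{0..B}. of_bool (a (g (Transposition.transpose 0 j b)) \<omega> \<ge> a (g j) \<omega>)) =
          (\<Sum>b\<in>{0..B}. of_bool (a (g b) \<omega> \<ge> a (g j) \<omega>) :: real)" for \<omega>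
        by (simp only: comp_def)
      then show ?thesis
        by (simp add: E_def del: sum_of_bool_eq)
    qed
    then show ?thesis
      using sum_PiE_swap[of j B "\<lambda>g. prob (E g 0)" ?S] j by simp
  qed
  \<comment> \<open>Summing over the \<open>B + 1\<close> slots brings in the counting bound, which
    applies to each fixed tuple \<open>g\<close>.\<close>
  have "(real B + 1) * (\<Sum>g\<in>?G. prob (E g 0)) = (\<Sum>j\<in>{0..B}. \<Sum>g\<in>?G. prob (E g j))"
    by (subst sum.cong[OF refl swap]) (simp_all add: add.commute)
  also have "\<dots> = (\<Sum>g\<in>?G. \<Sum>j\<in>{0..B}. prob (E g j))"
    by (rule sum.swap)
  also have "\<dots> \<le> (\<Sum>g\<in>?G. r)"
  proof (rule sum_mono)
    fix g assume g: "g \<in> ?G"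
    have "a (g j) \<in> borel_measurable M" if "j \<in> {0..B}" for j
    proof -
      have "(\<lambda>\<omega>. A (X \<omega>) (permute_labels n (g j) (y \<omega>)) (U \<omega>)) \<in> borel_measurable M"
        using measurable_compose[OF D[OF PiE_mem[OF g that]] A] by simp
      then show ?thesis by (simp add: a_def[abs_def])
    qed
    then show "(\<Sum>j\<in>{0..B}. prob (E g j)) \<le> r"
      unfolding E_def using r by (intro sum_prob_card_ge_le) auto
  qed
  also have "\<dots> = N ^ (B + 1) * r"
    by (simp add: card_PiE N_def)
  \<comment> \<open>The factor \<open>B + 1\<close> in \<open>r\<close> cancels the number of slots.
    Of \<open>N ^ (B + 1)\<close>, one factor \<open>N\<close> cancels the sum over
    \<open>\<tau>\<close>, and \<open>N ^ B\<close> remains for the draws.\<close>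
  finally have "(real B + 1) * (\<Sum>g\<in>?G. prob (E g 0)) \<le> (real B + 1) * (N ^ (B + 1) * \<alpha>)"
    by (simp add: r_def ac_simps)
  then have "N * (\<Sum>f\<in>?F. prob (E (f(0 := id)) 0)) \<le> N * (N ^ B * \<alpha>)"
    unfolding translate by (subst (asm) mult_le_cancel_left_pos) (simp_all add: ac_simps)
  then have "(\<Sum>f\<in>?F. prob (E (f(0 := id)) 0)) \<le> N ^ B * \<alpha>"
    using N by (subst (asm) mult_le_cancel_left_pos)
  then show ?thesis
    unfolding P_eq using N by (simp add: pos_divide_le_eq ac_simps)
qed

end
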